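(* Let $k$ be a positive integer, let $G$ be a graph, and let $A\in\mathcal{S}(G)$ be a matrix that has an eigenvalue $\lambda$ with an eigenvector $y$ all of whose entries are nonzero. Let $p(x)\in\mathbb{R}_k[x]$ be a polynomial such that $p(A)$ is positive semidefinite and $p(\lambda)>0$. Then $$\alpha_k(G)\leq\frac{y^\top y}{p(\lambda)}\max_{u\in V(G)}\frac{(p(A))_{uu}}{y_u^2}.$$
   Context: Graphs are finite, simple, undirected, with nonempty vertex set $V(G)$. $d(i,j)$ denotes the distance between vertices $i$ and $j$ in $G$ (with $d(i,j)=\infty$ if they lie in different components). A $k$-independent set of $G$ is a subset $U\subseteq V(G)$ with $d(i,j)>k$ for any two distinct $i,j\in U$; $\alpha_k(G)$ is the maximum size of a $k$-independent set. $\mathbb{R}_k[x]$ is the set of real polynomials of degree at most $k$. $\mathcal{S}(G)$ is the set of real symmetric matrices $A$ indexed by the vertices of $G$ such that $(A)_{ij}=0$ whenever $d(i,j)>1$ (diagonal entries are arbitrary). The eigenvector $y$ is real. *)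

theory Defs
  imports
    "HOL-Analysis.Analysis"
    "HOL-Computational_Algebra.Polynomial"
    "Graph_Theory.Graph_Theory"
begin

text \<open>
  Graphs are the finite, loop-free, symmetric pair digraphs of \<^locale>\<open>pair_graph\<close>: an undirected
  edge is the pair of opposite arcs.
\<close>

text \<open>
  Every arc weighs 1, so the weight of a walk is its length. The infimum over the empty set of walks
  is \<open>\<infinity>\<close>, the value for vertices in different components.
\<close>

definition graph_dist :: "'v pair_pre_digraph \<Rightarrow> 'v \<Rightarrow> 'v \<Rightarrow> ereal" where
  "graph_dist G u v = wf_digraph.\<mu> (with_proj G) (\<lambda>_. 1) u v"

definition k_independent :: "nat \<Rightarrow> 'v pair_pre_digraph \<Rightarrow> 'v set \<Rightarrow> bool" where
  "k_independent k G U \<longleftrightarrow>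
     U \<subseteq> pverts G \<and> (\<forall>i\<in>U. \<forall>j\<in>U. i \<noteq> j \<longrightarrow> graph_dist G i j > ereal (real k))"

definition k_independence_number :: "nat \<Rightarrow> 'v pair_pre_digraph \<Rightarrow> nat" where
  "k_independence_number k G = Max {card U | U. k_independent k G U}"

text \<open>
  Matrices are indexed by the vertex type, so this set is meant for graphs whose vertex set is the
  whole type.
\<close>

definition graph_matrices :: "'v::finite pair_pre_digraph \<Rightarrow> (real ^ 'v ^ 'v) set" where
  "graph_matrices G =
     {A. transpose A = A \<and> (\<forall>i j. graph_dist G i j > 1 \<longrightarrow> A $ i $ j = 0)}"

text \<open>
  The power and product of the ring class on \<^typ>\<open>real ^ 'v ^ 'v\<close> are taken entry by entry, so
  matrix powers and the evaluation of a polynomial at a matrix are defined from \<open>(**)\<close>.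
\<close>

primrec matrix_power :: "real ^ 'v ^ 'v \<Rightarrow> nat \<Rightarrow> real ^ 'v ^ 'v" where
  "matrix_power A 0 = mat 1"
| "matrix_power A (Suc n) = A ** matrix_power A n"

definition matrix_poly :: "real poly \<Rightarrow> real ^ 'v ^ 'v \<Rightarrow> real ^ 'v ^ 'v" where
  "matrix_poly p A = (\<Sum>i\<le>degree p. coeff p i *\<^sub>R matrix_power A i)"

definition is_eigenvector :: "real ^ 'v ^ 'v \<Rightarrow> real \<Rightarrow> real ^ 'v \<Rightarrow> bool" where
  "is_eigenvector A l y \<longleftrightarrow> y \<noteq> 0 \<and> A *v y = l *\<^sub>R y"

definition positive_semidefinite :: "real ^ 'v ^ 'v \<Rightarrow> bool" where
  "positive_semidefinite M \<longleftrightarrow> transpose M = M \<and> (\<forall>x. x \<bullet> (M *v x) \<ge> 0)"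

end

theory Submission
  imports Defs
begin

text \<open>
  Let \<open>M = p(A)\<close>. A nonzero entry of \<open>A ^ n\<close> forces distance at most \<open>n\<close>, so \<open>M\<close> vanishes off the
  diagonal on a \<open>k\<close>-independent set \<open>U\<close>. Since \<open>M y = p(\<theta>) y\<close>, splitting off the component of a
  vector \<open>x\<close> along \<open>y\<close> and using \<open>M \<ge> 0\<close> on the rest gives
  \<open>p(\<theta>) (x \<bullet> y)\<^sup>2 \<le> (y \<bullet> y) (x \<bullet> M x)\<close>. For \<open>x\<close> with entries \<open>1 / y\<^sub>u\<close> on \<open>U\<close> and \<open>0\<close> elsewhere,
  \<open>x \<bullet> y = |U|\<close> and \<open>x \<bullet> M x\<close> is the sum of \<open>M\<^sub>u\<^sub>u / y\<^sub>u\<^sup>2\<close> over \<open>U\<close>, at most \<open>|U|\<close> times the maximum.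
\<close>

section \<open>Distances and walks\<close>

context pair_wf_digraph
begin

lemma awalk_cost_unit: "awalk_cost (\<lambda>_. 1) p = real (length p)"
  by (induction p) auto

lemma graph_dist_le_iff:
  "graph_dist G u v \<le> ereal (real n) \<longleftrightarrow> (\<exists>p. awalk u p v \<and> length p \<le> n)"
proof
  assume "graph_dist G u v \<le> ereal (real n)"
  \<comment> \<open>An infimum below a strict bound yields a walk below that bound; lengths are
    integers, so being below \<open>n + 1\<close> means at most \<open>n\<close>.\<close>
  also have "ereal (real n) < ereal (real n + 1)"
    by simp
  finally have "\<mu> (\<lambda>_. 1) u v < ereal (real n + 1)"
    by (simp add: graph_dist_def)
  then obtain p where "awalk u p v" "real (length p) < real n + 1"
    unfolding \<mu>_def INF_less_iff by (auto simp: awalk_cost_unit)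
  then show "\<exists>p. awalk u p v \<and> length p \<le> n"
    by (intro exI[of _ p]) auto
next
  assume "\<exists>p. awalk u p v \<and> length p \<le> n"
  then obtain p where p: "awalk u p v" "length p \<le> n"
    by blast
  have "\<mu> (\<lambda>_. 1) u v \<le> ereal (real (length p))"
    using min_cost_le_walk_cost[OF p(1), of "\<lambda>_. 1"] by (simp add: awalk_cost_unit)
  also have "\<dots> \<le> ereal (real n)"
    using p(2) by simp
  finally show "graph_dist G u v \<le> ereal (real n)"
    by (simp add: graph_dist_def)
qed

lemma graph_dist_self_le: "u \<in> pverts G \<Longrightarrow> graph_dist G u u \<le> ereal (real n)"
  unfolding graph_dist_le_iff by (intro exI[of _ "[]"]) (simp add: awalk_Nil_iff)

lemma graph_dist_triangle:
  assumes "graph_dist G u w \<le> ereal (real m)" "graph_dist G w v \<le> ereal (real n)"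
  shows "graph_dist G u v \<le> ereal (real (m + n))"
proof -
  obtain p q where "awalk u p w" "length p \<le> m" "awalk w q v" "length q \<le> n"
    using assms unfolding graph_dist_le_iff by blast
  then show ?thesis
    unfolding graph_dist_le_iff by (intro exI[of _ "p @ q"]) (auto intro: awalk_appendI)
qed

end

section \<open>Polynomials of a matrix\<close>

text \<open>Some term of the sum for an entry of \<open>A ** matrix_power A n\<close> must be
  nonzero; its middle index \<open>w\<close> lies within distance 1 of \<open>u\<close> and, by
  induction, within \<open>n\<close> of \<open>v\<close>.\<close>

lemma matrix_power_nonzero_imp_dist_le:
  assumes "pair_wf_digraph G" "pverts G = UNIV" "A \<in> graph_matrices G"
    and "matrix_power A n $ u $ v \<noteq> 0"
  shows "graph_dist G u v \<le> ereal (real n)"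
  using assms(4)
proof (induction n arbitrary: u)
  case 0
  interpret pair_wf_digraph G by fact
  from 0 have "u = v"
    by (auto simp: mat_def split: if_splits)
  \<comment> \<open>The empty walk at \<open>v\<close> is a walk only if \<open>v\<close> is a
    vertex, which \<open>pverts G = UNIV\<close> supplies.\<close>
  then show ?case
    using graph_dist_self_le[of v 0] assms(2) by simp
next
  case (Suc n)
  interpret pair_wf_digraph G by fact
  have "(\<Sum>w\<in>UNIV. A $ u $ w * matrix_power A n $ w $ v) \<noteq> 0"
    using Suc.prems by (simp add: matrix_matrix_mult_def)
  then obtain w where w: "A $ u $ w \<noteq> 0" "matrix_power A n $ w $ v \<noteq> 0"
    by (metis (no_types, lifting) mult_eq_0_iff sum.neutral)
  have "graph_dist G u w \<le> ereal (real 1)"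
    using w(1) assms(3) by (force simp: graph_matrices_def one_ereal_def not_less[symmetric])
  from graph_dist_triangle[OF this Suc.IH[OF w(2)]] show ?case
    by simp
qed

lemma matrix_poly_nth:
  "matrix_poly p A $ u $ v = (\<Sum>i\<le>degree p. coeff p i * matrix_power A i $ u $ v)"
  by (simp add: matrix_poly_def)

lemma matrix_poly_eq_0_if_dist_gt:
  assumes "pair_wf_digraph G" "pverts G = UNIV" "A \<in> graph_matrices G"
    and "ereal (real (degree p)) < graph_dist G u v"
  shows "matrix_poly p A $ u $ v = 0"
proof -
  have "matrix_power A i $ u $ v = 0" if "i \<le> degree p" for i
  proof (rule ccontr)
    assume "matrix_power A i $ u $ v \<noteq> 0"
    from matrix_power_nonzero_imp_dist_le[OF assms(1-3) this]
    have "graph_dist G u v \<le> ereal (real (degree p))"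
      using that by (meson ereal_less_eq(3) of_nat_le_iff order_trans)
    with assms(4) show False
      by simp
  qed
  then show ?thesis
    by (simp add: matrix_poly_nth)
qed

lemma matrix_power_eigenvector:
  assumes "A *v y = l *\<^sub>R y"
  shows "matrix_power A n *v y = l ^ n *\<^sub>R y"
  by (induction n)
    (simp_all add: assms matrix_vector_mul_assoc[symmetric] matrix_vector_mult_scaleR mult.commute)

lemma matrix_poly_eigenvector:
  assumes "A *v y = l *\<^sub>R y"
  shows "matrix_poly p A *v y = poly p l *\<^sub>R y"
proof -
  have "(\<Sum>i\<in>I. coeff p i *\<^sub>R matrix_power A i) *v y
      = (\<Sum>i\<in>I. coeff p i *\<^sub>R (matrix_power A i *v y))" if "finite I" for I
    using that
    by induction (simp_all add: matrix_vector_mult_add_rdistrib scaleR_matrix_vector_assoc)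
  then have "matrix_poly p A *v y = (\<Sum>i\<le>degree p. coeff p i *\<^sub>R (l ^ i *\<^sub>R y))"
    by (simp add: matrix_poly_def matrix_power_eigenvector[OF assms])
  also have "\<dots> = poly p l *\<^sub>R y"
    by (simp add: poly_altdef scaleR_sum_left)
  finally show ?thesis .
qed

section \<open>Positive semidefinite matrices\<close>

lemma inner_matrix_vector_mult:
  fixes M :: "real ^ 'v::finite ^ 'v"
  shows "x \<bullet> (M *v z) = (\<Sum>u\<in>UNIV. \<Sum>v\<in>UNIV. x $ u * M $ u $ v * z $ v)"
  by (simp add: inner_vec_def matrix_vector_mult_def sum_distrib_left mult.assoc)

lemma positive_semidefinite_diag_nonneg:
  fixes M :: "real ^ 'v::finite ^ 'v"
  assumes "positive_semidefinite M"
  shows "0 \<le> M $ u $ u"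
proof -
  have "0 \<le> axis u 1 \<bullet> (M *v axis u 1)"
    using assms by (simp add: positive_semidefinite_def)
  also have "\<dots> = M $ u $ u"
    by (simp add: matrix_vector_mul_component inner_axis inner_axis' inner_commute)
  finally show ?thesis .
qed

text \<open>For \<open>l > 0\<close> this is the Cauchy-Schwarz inequality of the semidefinite form
  of \<open>M\<close> at \<open>x\<close> and \<open>y\<close>, divided by
  \<open>l * (y \<bullet> y)\<close> and then scaled by \<open>y \<bullet> y\<close>.\<close>

lemma positive_semidefinite_eigenvector_bound:
  fixes M :: "real ^ 'v::finite ^ 'v"
  assumes psd: "positive_semidefinite M" and ev: "M *v y = l *\<^sub>R y" and "y \<noteq> 0"
  shows "l * (x \<bullet> y)\<^sup>2 \<le> (y \<bullet> y) * (x \<bullet> (M *v x))"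
proof -
  have sym: "y \<bullet> (M *v x) = l * (x \<bullet> y)"
    using psd ev
    by (metis dot_lmul_matrix inner_commute inner_scaleR_right positive_semidefinite_def
        transpose_matrix_vector)
  have yy: "y \<bullet> y > 0"
    using \<open>y \<noteq> 0\<close> by simp
  \<comment> \<open>\<open>c *\<^sub>R y\<close> is the orthogonal projection of \<open>x\<close>
    onto the line of \<open>y\<close>.\<close>
  define c where "c = (x \<bullet> y) / (y \<bullet> y)"
  have c: "c * (y \<bullet> y) = x \<bullet> y"
    using yy by (simp add: c_def)
  have "0 \<le> (x - c *\<^sub>R y) \<bullet> (M *v (x - c *\<^sub>R y))"
    using psd by (simp add: positive_semidefinite_def)
  also have "\<dots> = x \<bullet> (M *v x) - 2 * c * l * (x \<bullet> y) + c * l * (c * (y \<bullet> y))"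
    by (simp add: matrix_vector_mult_diff_distrib matrix_vector_mult_scaleR ev sym
        inner_diff_left inner_diff_right algebra_simps)
  also have "\<dots> = x \<bullet> (M *v x) - l * (c * (x \<bullet> y))"
    by (simp add: c)
  finally have "(y \<bullet> y) * (l * (c * (x \<bullet> y))) \<le> (y \<bullet> y) * (x \<bullet> (M *v x))"
    using yy by (intro mult_left_mono) auto
  moreover have "(y \<bullet> y) * (l * (c * (x \<bullet> y))) = l * (x \<bullet> y)\<^sup>2"
    using c by (metis mult.assoc mult.commute power2_eq_square)
  ultimately show ?thesis
    by simp
qed

lemma positive_semidefinite_card_bound:
  fixes M :: "real ^ 'v::finite ^ 'v"
  assumes psd: "positive_semidefinite M" and ev: "M *v y = l *\<^sub>R y" and "l > 0"
    and y: "\<And>u. y $ u \<noteq> 0"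
    and off: "\<And>u v. u \<in> U \<Longrightarrow> v \<in> U \<Longrightarrow> u \<noteq> v \<Longrightarrow> M $ u $ v = 0"
    and m: "\<And>u. M $ u $ u / (y $ u)\<^sup>2 \<le> m"
  shows "real (card U) \<le> (y \<bullet> y) / l * m"
proof (cases "U = {}")
  case True
  \<comment> \<open>With \<open>U\<close> empty the left side is 0, so the bound only asks for a
    nonnegative right side.\<close>
  have "0 \<le> m"
    using positive_semidefinite_diag_nonneg[OF psd] m
    by (meson divide_nonneg_nonneg order_trans zero_le_power2)
  with True \<open>l > 0\<close> show ?thesis
    by simp
next
  case False
  define x :: "real ^ 'v" where "x = (\<chi> u. if u \<in> U then 1 / y $ u else 0)"
  have card_pos: "real (card U) > 0"
    using False by (simp add: card_gt_0_iff)
  have "y \<noteq> 0"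
    using y by (metis zero_index)
  have xy: "x \<bullet> y = real (card U)"
  proof -
    have "x \<bullet> y = (\<Sum>u\<in>UNIV. if u \<in> U then 1 else 0)"
      unfolding inner_vec_def by (intro sum.cong) (auto simp: x_def y)
    then show ?thesis
      by (simp add: sum.If_cases)
  qed
  \<comment> \<open>A term with \<open>u\<close> and \<open>v\<close> distinct vanishes: either one
    index is outside \<open>U\<close>, where \<open>x\<close> is 0, or \<open>off\<close>
    applies.\<close>
  have "x \<bullet> (M *v x) = (\<Sum>u\<in>UNIV. \<Sum>v\<in>UNIV. if v = u then x $ u * M $ u $ u * x $ u else 0)"
    unfolding inner_matrix_vector_mult by (intro sum.cong refl) (auto simp: x_def off)
  also have "\<dots> = (\<Sum>u\<in>UNIV. if u \<in> U then M $ u $ u / (y $ u)\<^sup>2 else 0)"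
    by (simp, intro sum.cong) (auto simp: x_def power2_eq_square)
  also have "\<dots> = (\<Sum>u\<in>U. M $ u $ u / (y $ u)\<^sup>2)"
    by (simp add: sum.If_cases)
  also have "\<dots> \<le> real (card U) * m"
    using m by (intro sum_bounded_above) auto
  finally have "(y \<bullet> y) * (x \<bullet> (M *v x)) \<le> (y \<bullet> y) * (real (card U) * m)"
    by (intro mult_left_mono) auto
  \<comment> \<open>The left side is quadratic in \<open>card U\<close> and the right side linear,
    so one factor, positive in this case, cancels.\<close>
  with positive_semidefinite_eigenvector_bound[OF psd ev \<open>y \<noteq> 0\<close>, of x]
  have "real (card U) * (l * real (card U)) \<le> real (card U) * ((y \<bullet> y) * m)"
    by (simp add: xy power2_eq_square mult_ac)
  then have "l * real (card U) \<le> (y \<bullet> y) * m"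
    using card_pos by (rule mult_left_le_imp_le)
  with \<open>l > 0\<close> show ?thesis
    by (simp add: field_simps)
qed

section \<open>The bound on the independence number\<close>

text \<open>The empty set is \<open>k\<close>-independent and the vertex type is finite, so the
  maximum ranges over a nonempty finite set.\<close>

lemma k_independence_number_attained:
  fixes G :: "'v::finite pair_pre_digraph"
  obtains U where "k_independent k G U" "card U = k_independence_number k G"
proof -
  have "k_independent k G {}"
    by (simp add: k_independent_def)
  then have "k_independence_number k G \<in> {card U | U. k_independent k G U}"
    unfolding k_independence_number_def by (intro Max_in) auto
  then show thesis
    using that by auto
qed

theorem theorem6:
  fixes k :: nat
    and G :: "'v::finite pair_pre_digraph"
    and A :: "real ^ 'v ^ 'v"
    and \<theta> :: real
    and y :: "real ^ 'v"
    and p :: "real poly"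
  assumes "k > 0"
    and "pair_graph G" and "pverts G = UNIV"
    and "A \<in> graph_matrices G"
    and "is_eigenvector A \<theta> y" and "\<forall>u. y $ u \<noteq> 0"
    and "degree p \<le> k"
    and "positive_semidefinite (matrix_poly p A)"
    and "poly p \<theta> > 0"
  shows "real (k_independence_number k G) \<le>
    (y \<bullet> y) / poly p \<theta> * (MAX u\<in>pverts G. matrix_poly p A $ u $ u / (y $ u)\<^sup>2)"
proof -
  interpret pair_graph G by fact
  have wf: "pair_wf_digraph G"
    by unfold_locales
  obtain U where U: "k_independent k G U" "card U = k_independence_number k G"
    by (rule k_independence_number_attained)
  have "real (card U) \<le>
    (y \<bullet> y) / poly p \<theta> * (MAX u\<in>pverts G. matrix_poly p A $ u $ u / (y $ u)\<^sup>2)"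
  proof (rule positive_semidefinite_card_bound)
    show "matrix_poly p A *v y = poly p \<theta> *\<^sub>R y"
      using assms(5) by (intro matrix_poly_eigenvector) (simp add: is_eigenvector_def)
    fix u v assume "u \<in> U" "v \<in> U" "u \<noteq> v"
    with U(1) have "ereal (real k) < graph_dist G u v"
      by (simp add: k_independent_def)
    then have "ereal (real (degree p)) < graph_dist G u v"
      using \<open>degree p \<le> k\<close> by (meson ereal_less_eq(3) le_less_trans of_nat_le_iff)
    then show "matrix_poly p A $ u $ v = 0"
      by (rule matrix_poly_eq_0_if_dist_gt[OF wf assms(3,4)])
  next
    fix u
    show "matrix_poly p A $ u $ u / (y $ u)\<^sup>2
      \<le> (MAX u\<in>pverts G. matrix_poly p A $ u $ u / (y $ u)\<^sup>2)"
      using assms(3) by (intro Max_ge) auto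
  qed (use assms in auto)
  then show ?thesis
    by (simp add: U(2))
qed

end
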